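(* Every finite subset $A \subseteq \mathbb{Z} \setminus \{0\}$ has a valid ordering, i.e., there is an ordering $a_1, \ldots, a_{|A|}$ of the elements of $A$ such that the partial sums $a_1,\ a_1+a_2,\ \ldots,\ a_1+a_2+\cdots+a_{|A|}$ are pairwise distinct. *)

theory Defs
  imports Main
begin

(* The list xs is the ordering a_1, ..., a_n of A. The sum of its first k entries
   is a_1 + ... + a_k, taken for 1 <= k <= n only: the empty sum is not among the
   partial sums, so a nonempty partial sum may be 0. *)
definition valid_ordering :: "'a::ab_group_add set \<Rightarrow> 'a list \<Rightarrow> bool" where
  "valid_ordering A xs \<longleftrightarrow>
     distinct xs \<and> set xs = A \<and>
     inj_on (\<lambda>k. sum_list (take k xs)) {1..length xs}"

end

theory Submission
  imports Defs
begin

text \<open>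
  List the positive elements first, then the negative ones, so that no nonempty contiguous block
  sums to 0, except possibly the whole list. Such a list is built from the middle outwards, by
  induction on \<open>A\<close>. By the symmetry \<open>A \<mapsto> -A\<close> (which reverses lists) let \<open>\<Sum>A \<ge> 0\<close>. At most one
  \<open>x\<close> satisfies \<open>\<Sum>(A - {x}) = 0\<close>, so there is a positive \<open>x\<close> that does not, unless \<open>A\<close> is a
  singleton. Prepend \<open>x\<close> to a list for \<open>A - {x}\<close>. A new proper block of sum 0 would be a proper prefix
  that ends among the negative elements, and then \<open>\<Sum>A < 0\<close>.
\<close>

text \<open>The whole list is exempt from the block condition because \<open>A\<close> itself may
  sum to 0. Blocks are middle parts of a split, so prefixes and suffixes are covered by empty
  \<open>us\<close> or \<open>ws\<close>.\<close>

definition good_ordering :: "int set \<Rightarrow> int list \<Rightarrow> bool" where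
  "good_ordering A xs \<longleftrightarrow>
     distinct xs \<and> set xs = A \<and>
     (\<exists>ps ns. xs = ps @ ns \<and> (\<forall>p\<in>set ps. p > 0) \<and> (\<forall>n\<in>set ns. n < 0)) \<and>
     (\<forall>us vs ws. xs = us @ vs @ ws \<longrightarrow> vs \<noteq> [] \<longrightarrow> sum_list vs = 0 \<longrightarrow> us = [] \<and> ws = [])"

lemma good_orderingI:
  assumes "distinct xs" "set xs = A" "xs = ps @ ns"
    and "\<And>p. p \<in> set ps \<Longrightarrow> p > 0" "\<And>n. n \<in> set ns \<Longrightarrow> n < 0"
    and "\<And>us vs ws. xs = us @ vs @ ws \<Longrightarrow> vs \<noteq> [] \<Longrightarrow> sum_list vs = 0 \<Longrightarrow> us = [] \<and> ws = []"
  shows "good_ordering A xs"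
  using assms unfolding good_ordering_def by blast

lemma good_orderingE:
  assumes "good_ordering A xs"
  obtains ps ns where "distinct xs" "set xs = A" "xs = ps @ ns"
    and "\<And>p. p \<in> set ps \<Longrightarrow> p > 0" "\<And>n. n \<in> set ns \<Longrightarrow> n < 0"
    and "\<And>us vs ws. xs = us @ vs @ ws \<Longrightarrow> vs \<noteq> [] \<Longrightarrow> sum_list vs = 0 \<Longrightarrow> us = [] \<and> ws = []"
  using assms unfolding good_ordering_def by blast

lemma sum_list_neg:
  fixes xs :: "int list"
  assumes "\<And>x. x \<in> set xs \<Longrightarrow> x < 0" "xs \<noteq> []"
  shows "sum_list xs < 0"
  using assms(2,1)
  by (induction xs rule: list_nonempty_induct) (auto intro: add_neg_neg)

lemma sum_list_uminus_rev: "sum_list (map uminus (rev xs)) = - sum_list (xs :: int list)"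
  by (induction xs) auto

text \<open>Negation swaps the two signs and reversal restores the order, positives first. Blocks
  correspond to blocks, with negated sums.\<close>

lemma good_ordering_uminus:
  assumes "good_ordering A xs"
  shows "good_ordering (uminus ` A) (map uminus (rev xs))"
proof -
  from assms obtain ps ns where xs: "distinct xs" "set xs = A" "xs = ps @ ns"
    and pos: "\<And>p. p \<in> set ps \<Longrightarrow> p > 0" and neg: "\<And>n. n \<in> set ns \<Longrightarrow> n < 0"
    and block: "\<And>us vs ws. xs = us @ vs @ ws \<Longrightarrow> vs \<noteq> [] \<Longrightarrow> sum_list vs = 0 \<Longrightarrow> us = [] \<and> ws = []"
    by (rule good_orderingE) blast
  let ?m = "\<lambda>zs. map uminus (rev zs) :: int list"
  show ?thesis
  proof (rule good_orderingI[where ps = "?m ns" and ns = "?m ps"])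
    fix us vs ws assume eq: "?m xs = us @ vs @ ws" and "vs \<noteq> []" "sum_list vs = 0"
    \<comment> \<open>\<open>?m\<close> is an involution, so a split of \<open>?m xs\<close> pulls
      back to a split of \<open>xs\<close> with the outer parts exchanged.\<close>
    have "xs = ?m (?m xs)"
      by (simp add: rev_map o_def)
    then have "xs = ?m ws @ ?m vs @ ?m us"
      unfolding eq by simp
    from block[OF this] \<open>vs \<noteq> []\<close> \<open>sum_list vs = 0\<close> show "us = [] \<and> ws = []"
      by (simp only: sum_list_uminus_rev) simp
  qed (use xs pos neg in \<open>auto simp: distinct_map\<close>)
qed

lemma good_ordering_Cons:
  assumes good: "good_ordering A xs" and "x > 0" "x \<notin> A"
    and nonneg: "x + sum_list xs \<ge> 0" and nz: "xs = [] \<or> sum_list xs \<noteq> 0"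
  shows "good_ordering (insert x A) (x # xs)"
proof -
  from good obtain ps ns where xs: "distinct xs" "set xs = A" "xs = ps @ ns"
    and pos: "\<And>p. p \<in> set ps \<Longrightarrow> p > 0" and neg: "\<And>n. n \<in> set ns \<Longrightarrow> n < 0"
    and block: "\<And>us vs ws. xs = us @ vs @ ws \<Longrightarrow> vs \<noteq> [] \<Longrightarrow> sum_list vs = 0 \<Longrightarrow> us = [] \<and> ws = []"
    by (rule good_orderingE) blast
  show ?thesis
  proof (rule good_orderingI[where ps = "x # ps" and ns = ns])
    fix us vs ws assume eq: "x # xs = us @ vs @ ws" and vs: "vs \<noteq> []" "sum_list vs = 0"
    show "us = [] \<and> ws = []"
    proof (cases us)
      case (Cons u us')
      with eq have "xs = us' @ vs @ ws" by simp
      \<comment> \<open>The block lies inside \<open>xs\<close>, so it would have to be all of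
        \<open>xs\<close>, whose sum is nonzero by \<open>nz\<close>.\<close>
      with block[OF this vs] vs nz show ?thesis by auto
    next
      case Nil
      with eq vs obtain vs' where vs': "vs = x # vs'" "xs = vs' @ ws"
        by (auto simp: Cons_eq_append_conv)
      have "sum_list vs' < 0"
        using vs' vs \<open>x > 0\<close> by simp
      have "ws = []"
      proof (rule ccontr)
        assume "ws \<noteq> []"
        \<comment> \<open>As \<open>vs'\<close> sums to \<open>- x\<close>, it cannot end among the
          positive elements, so only negative ones remain for \<open>ws\<close>.\<close>
        have "set ws \<subseteq> set ns"
        proof -
          from vs' xs have "vs' @ ws = ps @ ns" by simp
          then consider zs where "ps = vs' @ zs" | zs where "ns = zs @ ws"
            by (auto simp: append_eq_append_conv2)
          then show ?thesis
          proof cases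
            case 1
            with pos have "sum_list vs' \<ge> 0"
              by (intro sum_list_nonneg) (auto intro: less_imp_le)
            with \<open>sum_list vs' < 0\<close> show ?thesis by simp
          qed auto
        qed
        with neg \<open>ws \<noteq> []\<close> have "sum_list ws < 0"
          by (intro sum_list_neg) auto
        \<comment> \<open>The block \<open>x # vs'\<close> sums to 0, so the total
          \<open>x + sum_list xs\<close> equals \<open>sum_list ws\<close>.\<close>
        with nonneg vs vs' show False by simp
      qed
      with Nil show ?thesis by simp
    qed
  qed (use xs pos neg \<open>x > 0\<close> \<open>x \<notin> A\<close> in auto)
qed

lemma ex_positive_remove_sum_nonzero:
  fixes A :: "int set"
  assumes "finite A" "A \<noteq> {}" "0 \<notin> A" "\<Sum>A \<ge> 0"
  obtains x where "x \<in> A" "x > 0" "A = {x} \<or> \<Sum>(A - {x}) \<noteq> 0"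
proof -
  have "\<exists>x\<in>A. x > 0"
  proof (rule ccontr)
    assume "\<not> (\<exists>x\<in>A. x > 0)"
    with assms have "\<forall>x\<in>A. x < 0"
      by (metis linorder_neqE_linordered_idom)
    then have "\<Sum>A < 0"
      using assms sum_strict_mono[of A "\<lambda>x. x" "\<lambda>_. 0"] by simp
    with assms show False by simp
  qed
  then obtain x where x: "x \<in> A" "x > 0" by blast
  show thesis
  proof (cases "A = {x} \<or> \<Sum>(A - {x}) \<noteq> 0")
    case False
    with x assms have "A - {x} \<noteq> {}" and sum0: "\<Sum>(A - {x}) = 0" by auto
    have "\<exists>y\<in>A - {x}. y > 0"
    proof (rule ccontr)
      assume "\<not> (\<exists>y\<in>A - {x}. y > 0)"
      with assms have "\<forall>y\<in>A - {x}. y < 0"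
        by (metis DiffD1 linorder_neqE_linordered_idom)
      then have "\<Sum>(A - {x}) < 0"
        using assms \<open>A - {x} \<noteq> {}\<close> sum_strict_mono[of "A - {x}" "\<lambda>x. x" "\<lambda>_. 0"] by simp
      with sum0 show False by simp
    qed
    then obtain y where y: "y \<in> A" "y \<noteq> x" "y > 0" by blast
    \<comment> \<open>From \<open>sum0\<close> the total of \<open>A\<close> is \<open>x\<close>, so
      removing \<open>y\<close> leaves \<open>x - y\<close>.\<close>
    have "\<Sum>(A - {y}) \<noteq> 0"
      using sum0 x y assms by (simp add: sum_diff1)
    with y show thesis by (intro that[of y]) auto
  qed (use x that in blast)
qed

text \<open>The induction hypothesis is an assumption here so that the step can be applied to
  \<open>A\<close> or to its negation, whichever has nonnegative sum.\<close>

lemma good_ordering_step: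
  fixes A :: "int set"
  assumes "finite A" "A \<noteq> {}" "0 \<notin> A" "\<Sum>A \<ge> 0"
    and IH: "\<And>B. B \<subset> A \<Longrightarrow> \<exists>xs. good_ordering B xs"
  shows "\<exists>xs. good_ordering A xs"
proof -
  obtain x where x: "x \<in> A" "x > 0" "A = {x} \<or> \<Sum>(A - {x}) \<noteq> 0"
    using ex_positive_remove_sum_nonzero[OF assms(1-4)] .
  then obtain xs where xs: "good_ordering (A - {x}) xs"
    using IH[of "A - {x}"] by blast
  then have set: "set xs = A - {x}" and "distinct xs"
    by (simp_all only: good_ordering_def)
  then have sum: "sum_list xs = \<Sum>(A - {x})"
    using sum_list_distinct_conv_sum_set[of xs "\<lambda>y. y"] by simp
  have "x + sum_list xs \<ge> 0"
    using sum x assms by (simp add: sum_diff1)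
  moreover have "xs = [] \<or> sum_list xs \<noteq> 0"
    using x(3) sum set by (metis Diff_cancel set_empty)
  ultimately have "good_ordering (insert x (A - {x})) (x # xs)"
    using xs x by (intro good_ordering_Cons) auto
  then show ?thesis
    unfolding insert_Diff[OF x(1)] by blast
qed

lemma ex_good_ordering:
  fixes A :: "int set"
  assumes "finite A" "0 \<notin> A"
  shows "\<exists>xs. good_ordering A xs"
  using assms
proof (induction A rule: finite_psubset_induct)
  case (psubset A)
  have IH: "\<exists>xs. good_ordering B xs" if "B \<subset> A" for B
    using psubset that by blast
  show ?case
  proof (cases "A = {}")
    case True
    have "good_ordering {} []"
      by (rule good_orderingI[where ps = "[]" and ns = "[]"]) simp_all
    with True show ?thesis by blast
  next
    case False
    show ?thesis
    proof (cases "\<Sum>A \<ge> 0")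
      case True
      from good_ordering_step[OF psubset(1) False \<open>0 \<notin> A\<close> this IH] show ?thesis
        by blast
    next
      case neg: False
      have "\<exists>xs. good_ordering (uminus ` A) xs"
      proof (rule good_ordering_step)
        show "\<Sum>(uminus ` A) \<ge> 0"
          using neg by (simp add: sum.reindex sum_negf)
      next
        \<comment> \<open>The hypothesis is available only below \<open>A\<close>: it is used for
          the negation of \<open>B\<close>, and the resulting list is negated and reversed
          back.\<close>
        fix B assume "B \<subset> uminus ` A"
        then have "uminus ` B \<subset> uminus ` uminus ` A"
          using inj_image_subset_iff[OF inj_uminus] by blast
        then have "uminus ` B \<subset> A"
          by (simp add: image_image)
        from IH[OF this] obtain xs where "good_ordering (uminus ` B) xs" ..
        from good_ordering_uminus[OF this]
        have "good_ordering B (map uminus (rev xs))"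
          by (simp add: image_image)
        then show "\<exists>xs. good_ordering B xs" ..
      qed (use False psubset(1) \<open>0 \<notin> A\<close> in auto)
      then obtain xs where "good_ordering (uminus ` A) xs" ..
      from good_ordering_uminus[OF this]
      have "good_ordering A (map uminus (rev xs))"
        by (simp add: image_image)
      then show ?thesis ..
    qed
  qed
qed

text \<open>Two partial sums differ by the sum of the block between them. The shorter prefix has at
  least one entry, so this block is not the whole list and its sum is nonzero.\<close>

lemma good_ordering_imp_valid_ordering:
  assumes "good_ordering A xs"
  shows "valid_ordering A xs"
proof -
  have "inj_on (\<lambda>k. sum_list (take k xs)) {1..length xs}"
  proof (rule linorder_inj_onI')
    fix i j assume ij: "i < j" "i \<in> {1..length xs}" "j \<in> {1..length xs}"
    let ?vs = "take (j - i) (drop i xs)"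
    have take: "take j xs = take i xs @ ?vs"
      using ij take_add[of i "j - i" xs] by simp
    then have "xs = take i xs @ ?vs @ drop j xs"
      by (metis append.assoc append_take_drop_id)
    moreover have "take i xs \<noteq> []" "?vs \<noteq> []"
      using ij by auto
    ultimately have "sum_list ?vs \<noteq> 0"
      using assms unfolding good_ordering_def by blast
    then show "sum_list (take i xs) \<noteq> sum_list (take j xs)"
      by (simp add: take)
  qed
  with assms show ?thesis
    by (simp only: valid_ordering_def good_ordering_def)
qed

theorem theorem3:
  fixes A :: "int set"
  assumes "finite A" and "A \<subseteq> UNIV - {0}"
  shows "\<exists>xs. valid_ordering A xs"
  using ex_good_ordering[of A] good_ordering_imp_valid_ordering assms by blast

end
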